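(* Let $C=(c_{ij})$ and $C'=(c'_{ij})$ be $n\times n$ matrices with row-sum vectors $(r_1,\ldots,r_n)^T$ and $(r'_1,\ldots,r'_n)^T$ respectively. Assume that (i) $c_{ij}\le c'_{ij}$ for all $1\le i\le n$, $1\le j\le n-1$, and $r_i\le r'_i$ for all $1\le i\le n$; (ii) $C'$ has a rooted eigenvector $v'=(v'_1,\ldots,v'_n)^T$ for $\lambda'$, for some $\lambda'\in\mathbb{R}$; (iii) $C$ has a nonnegative left eigenvector $v^T=(v_1,\ldots,v_n)$ for $\lambda\in\mathbb{R}$; (iv) $v^Tv'>0$. Then $\lambda\le\lambda'$. Moreover, $\lambda=\lambda'$ if and only if both of the following hold: (a) if $v'_n\ne 0$, then $r_i=r'_i$ for all $1\le i\le n$ with $v_i\ne 0$; (b) $c'_{ij}=c_{ij}$ for all $1\le i\le n$, $1\le j\le n-1$ with $v_i\ne 0$ and $v'_j>v'_n$.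
   Context: All matrices and vectors are real. The row-sum vector of $C=(c_{ij})$ is $(r_1,\ldots,r_n)^T$ with $r_i=\sum_{j=1}^n c_{ij}$. A column vector $v'=(v'_1,\ldots,v'_n)^T$ is called rooted if $v'_j\ge v'_n\ge 0$ for $1\le j\le n-1$. Eigenvectors are nonzero; "eigenvector" means right eigenvector ($C'v'=\lambda'v'$), and a left eigenvector $v^T$ of $C$ for $\lambda$ satisfies $v^TC=\lambda v^T$. Nonnegative means entrywise nonnegative. *)

theory Defs
  imports "Jordan_Normal_Form.Char_Poly"
begin

text \<open>
  Vectors and matrices are indexed from 0: the last index, usually written \<open>n\<close>, is \<open>n - 1\<close>,
  and the range \<open>1 \<le> j \<le> n - 1\<close> becomes \<open>j < n - 1\<close>.
\<close>

definition row_sum_vec :: "'a :: comm_monoid_add mat \<Rightarrow> 'a vec" where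
  "row_sum_vec C = vec (dim_row C) (\<lambda>i. \<Sum>j<dim_col C. C $$ (i, j))"

text \<open>
  Rootedness is only meaningful in positive dimension. In dimension 1 the condition is read as
  nonnegativity of the single entry.
\<close>

definition rooted :: "'a :: {zero, ord} vec \<Rightarrow> bool" where
  "rooted v \<longleftrightarrow>
     0 \<le> v $ (dim_vec v - 1) \<and> (\<forall>j < dim_vec v - 1. v $ (dim_vec v - 1) \<le> v $ j)"

text \<open>
  The counterpart of \<^const>\<open>eigenvector\<close>, with the equation read between row vectors.
\<close>

definition left_eigenvector :: "'a :: comm_ring_1 mat \<Rightarrow> 'a vec \<Rightarrow> 'a \<Rightarrow> bool" where
  "left_eigenvector A v k \<longleftrightarrow>
     v \<in> carrier_vec (dim_row A) \<and> v \<noteq> 0\<^sub>v (dim_row A) \<and> mat_of_row v * A = k \<cdot>\<^sub>m mat_of_row v"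

end

theory Submission
  imports Defs
begin

text \<open>
  Pairing the two eigenvector equations with each other gives
  \<open>(\<lambda>' - \<lambda>) (v \<bullet> v') = v \<bullet> ((C' - C) v')\<close>. Summation by parts in each row, with \<open>t\<close> the last
  entry of \<open>v'\<close>, turns the right-hand side into
  \<open>\<Sum>\<^sub>i v\<^sub>i (t (r'\<^sub>i - r\<^sub>i) + \<Sum>\<^sub>j (c'\<^sub>i\<^sub>j - c\<^sub>i\<^sub>j) (v'\<^sub>j - t))\<close>, in which every summand is
  nonnegative; it vanishes exactly when all summands do.
\<close>

lemma left_eigenvector_transpose:
  assumes C: "C \<in> carrier_mat n n" and ev: "left_eigenvector C v lam"
  shows "C\<^sup>T *\<^sub>v v = lam \<cdot>\<^sub>v v"
proof (rule eq_vecI)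
  have v: "v \<in> carrier_vec n" and eq: "mat_of_row v * C = lam \<cdot>\<^sub>m mat_of_row v"
    using ev C by (auto simp: left_eigenvector_def)
  fix j assume "j < dim_vec (lam \<cdot>\<^sub>v v)"
  hence j: "j < n" using v by simp
  \<comment> \<open>The row-vector equation is one between matrices with a single row; its entry
    \<open>(0, j)\<close> is a scalar product with column \<open>j\<close> of
    \<open>C\<close>.\<close>
  have "v \<bullet> col C j = lam * v $ j"
    using arg_cong[OF eq, of "\<lambda>M. M $$ (0, j)"] j C v by simp
  thus "(C\<^sup>T *\<^sub>v v) $ j = (lam \<cdot>\<^sub>v v) $ j"
    using j C v comm_scalar_prod[of v n "col C j"] by simp
qed (use C ev in \<open>auto simp: left_eigenvector_def\<close>)

text \<open>In the form \<open>v \<bullet> (C' *\<^sub>v v')\<close> the matrix acts to the right on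
  \<open>v'\<close>, and in \<open>v \<bullet> (C *\<^sub>v v')\<close> it is moved to the left onto
  \<open>v\<close>. Each form is thus an eigenvalue times the same number
  \<open>v \<bullet> v'\<close>.\<close>

lemma eigenvalue_diff_scalar_prod:
  fixes C C' :: "'a :: comm_ring_1 mat"
  assumes C: "C \<in> carrier_mat n n" and C': "C' \<in> carrier_mat n n"
    and right_ev: "eigenvector C' v' lam'" and left_ev: "left_eigenvector C v lam"
  shows "(lam' - lam) * (v \<bullet> v') = v \<bullet> ((C' - C) *\<^sub>v v')"
proof -
  have v: "v \<in> carrier_vec n" using left_ev C by (simp add: left_eigenvector_def)
  have v': "v' \<in> carrier_vec n" and eq': "C' *\<^sub>v v' = lam' \<cdot>\<^sub>v v'"
    using right_ev C' by (auto simp: eigenvector_def)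
  have "v \<bullet> (C *\<^sub>v v') = lam * (v \<bullet> v')"
    using transpose_vec_mult_scalar[OF C v' v] left_eigenvector_transpose[OF C left_ev] v v'
    by simp
  moreover have "v \<bullet> (C' *\<^sub>v v') = lam' * (v \<bullet> v')"
    using eq' v v' by simp
  moreover have "v \<bullet> ((C' - C) *\<^sub>v v') = v \<bullet> (C' *\<^sub>v v') - v \<bullet> (C *\<^sub>v v')"
    using C C' v v'
    by (simp add: minus_mult_distrib_mat_vec[OF C' C v'] scalar_prod_minus_distrib[of _ n])
  ultimately show ?thesis by (simp add: algebra_simps)
qed

text \<open>Split each \<open>x $ j\<close> into \<open>x $ (n - 1)\<close> plus a remainder. The
  constant part collects the row sum, and the remainder vanishes at the last index, so the last
  column enters only through the row sum.\<close>

lemma mult_mat_vec_last_entry: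
  fixes A :: "'a :: comm_ring_1 mat"
  assumes A: "A \<in> carrier_mat k n" and x: "x \<in> carrier_vec n" and n: "n > 0" and i: "i < k"
  shows "(A *\<^sub>v x) $ i = x $ (n - 1) * row_sum_vec A $ i
           + (\<Sum>j<n - 1. A $$ (i, j) * (x $ j - x $ (n - 1)))"
proof -
  obtain m where m: "n = Suc m" using n by (cases n) auto
  have "(A *\<^sub>v x) $ i = (\<Sum>j<n. A $$ (i, j) * x $ j)"
    using A x i by (simp add: scalar_prod_def atLeast0LessThan)
  thus ?thesis using A i m
    by (simp add: row_sum_vec_def right_diff_distrib sum_subtractf sum_distrib_left algebra_simps)
qed

lemma row_sum_vec_diff:
  fixes A B :: "'a :: ab_group_add mat"
  assumes "A \<in> carrier_mat k n" "B \<in> carrier_mat k n" "i < k"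
  shows "row_sum_vec (A - B) $ i = row_sum_vec A $ i - row_sum_vec B $ i"
  using assms by (simp add: row_sum_vec_def sum_subtractf)

theorem theorem4p3:
  fixes n :: nat and C C' :: "real mat" and v v' :: "real vec" and lam lam' :: real
  assumes C: "C \<in> carrier_mat n n" and C': "C' \<in> carrier_mat n n"
    and entries_le: "\<And>i j. i < n \<Longrightarrow> j < n - 1 \<Longrightarrow> C $$ (i, j) \<le> C' $$ (i, j)"
    and row_sums_le: "\<And>i. i < n \<Longrightarrow> row_sum_vec C $ i \<le> row_sum_vec C' $ i"
    and right_ev: "eigenvector C' v' lam'" and rooted: "rooted v'"
    and left_ev: "left_eigenvector C v lam" and nonneg: "0\<^sub>v n \<le> v"
    and pos: "v \<bullet> v' > 0"
  shows "lam \<le> lam' \<and>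
    (lam = lam' \<longleftrightarrow>
      (v' $ (n - 1) \<noteq> 0 \<longrightarrow>
         (\<forall>i<n. v $ i \<noteq> 0 \<longrightarrow> row_sum_vec C $ i = row_sum_vec C' $ i)) \<and>
      (\<forall>i<n. \<forall>j<n - 1. v $ i \<noteq> 0 \<and> v' $ j > v' $ (n - 1) \<longrightarrow>
         C' $$ (i, j) = C $$ (i, j)))"
proof -
  define t where "t = v' $ (n - 1)"
  \<comment> \<open>\<open>R\<close> measures the gap in the row sums and leads to (a);
    \<open>E\<close> measures the gap in the entries and leads to (b).\<close>
  define R where "R i = t * (row_sum_vec C' $ i - row_sum_vec C $ i)" for i
  define E where "E i j = (C' $$ (i, j) - C $$ (i, j)) * (v' $ j - t)" for i j
  define D where "D i = R i + (\<Sum>j<n - 1. E i j)" for i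
  have v: "v \<in> carrier_vec n" using left_ev C by (simp add: left_eigenvector_def)
  have v': "v' \<in> carrier_vec n" using right_ev C' by (simp add: eigenvector_def)
  \<comment> \<open>In dimension 0 the scalar product is an empty sum, hence not positive.\<close>
  have n: "n > 0" using pos v v' by (cases n) (auto simp: scalar_prod_def)
  have v_nonneg: "0 \<le> v $ i" if "i < n" for i
    using nonneg that v by (auto simp: less_eq_vec_def)
  have t_nonneg: "0 \<le> t" and t_le: "\<And>j. j < n - 1 \<Longrightarrow> t \<le> v' $ j"
    using rooted v' by (auto simp: rooted_def t_def)
  have R_nonneg: "0 \<le> R i" if "i < n" for i
    using row_sums_le[OF that] t_nonneg by (simp add: R_def)
  have E_nonneg: "0 \<le> E i j" if "i < n" "j < n - 1" for i j
    using entries_le[OF that] t_le[OF that(2)] by (simp add: E_def)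
  have E_sum_nonneg: "0 \<le> (\<Sum>j<n - 1. E i j)" if "i < n" for i
    using E_nonneg[OF that] by (intro sum_nonneg) auto
  have term_nonneg: "0 \<le> v $ i * D i" if "i < n" for i
    using v_nonneg[OF that] R_nonneg[OF that] E_sum_nonneg[OF that] by (simp add: D_def)
  have "((C' - C) *\<^sub>v v') $ i = D i" if "i < n" for i
    using mult_mat_vec_last_entry[OF minus_carrier_mat[OF C, of C'] v' n that]
      row_sum_vec_diff[OF C' C that] C C' that
    by (simp add: D_def R_def E_def t_def)
  hence key: "(lam' - lam) * (v \<bullet> v') = (\<Sum>i<n. v $ i * D i)"
    using eigenvalue_diff_scalar_prod[OF C C' right_ev left_ev] C C'
    by (simp add: scalar_prod_def atLeast0LessThan)
  have "0 \<le> (lam' - lam) * (v \<bullet> v')"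
    unfolding key using term_nonneg by (intro sum_nonneg) auto
  \<comment> \<open>The factor \<open>v \<bullet> v'\<close> is positive, so the sign is that of
    \<open>lam' - lam\<close>.\<close>
  hence le: "lam \<le> lam'" using pos by (simp add: zero_le_mult_iff)
  have D_zero_iff: "D i = 0 \<longleftrightarrow> R i = 0 \<and> (\<forall>j<n - 1. E i j = 0)" if "i < n" for i
  proof -
    have "(\<Sum>j<n - 1. E i j) = 0 \<longleftrightarrow> (\<forall>j<n - 1. E i j = 0)"
      using E_nonneg[OF that] by (subst sum_nonneg_eq_0_iff) auto
    thus ?thesis
      unfolding D_def using add_nonneg_eq_0_iff[OF R_nonneg[OF that] E_sum_nonneg[OF that]] by simp
  qed
  \<comment> \<open>A product vanishes iff one factor does; read as an implication, this yields the
    proviso in (a). For \<open>E\<close>, rootedness turns \<open>v' $ j \<noteq> t\<close> into the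
    strict inequality of (b).\<close>
  have R_zero_iff: "R i = 0 \<longleftrightarrow> (t \<noteq> 0 \<longrightarrow> row_sum_vec C $ i = row_sum_vec C' $ i)" for i
    by (auto simp: R_def)
  have E_zero_iff: "E i j = 0 \<longleftrightarrow> (v' $ j > t \<longrightarrow> C' $$ (i, j) = C $$ (i, j))"
    if "j < n - 1" for i j
    using t_le[OF that] by (auto simp: E_def)
  have "lam = lam' \<longleftrightarrow> (\<Sum>i<n. v $ i * D i) = 0"
    unfolding key[symmetric] using pos by auto
  also have "\<dots> \<longleftrightarrow> (\<forall>i<n. v $ i * D i = 0)"
    using term_nonneg by (subst sum_nonneg_eq_0_iff) auto
  also have "\<dots> \<longleftrightarrow> (\<forall>i<n. v $ i \<noteq> 0 \<longrightarrow> R i = 0 \<and> (\<forall>j<n - 1. E i j = 0))"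
    using D_zero_iff by auto
  \<comment> \<open>Since \<open>t\<close> is the same for all rows, the proviso
    \<open>t \<noteq> 0\<close> can be moved in front of the quantifier over
    \<open>i\<close>.\<close>
  also have "\<dots> \<longleftrightarrow>
      (t \<noteq> 0 \<longrightarrow> (\<forall>i<n. v $ i \<noteq> 0 \<longrightarrow> row_sum_vec C $ i = row_sum_vec C' $ i)) \<and>
      (\<forall>i<n. \<forall>j<n - 1. v $ i \<noteq> 0 \<and> v' $ j > t \<longrightarrow> C' $$ (i, j) = C $$ (i, j))"
    using R_zero_iff E_zero_iff by blast
  finally show ?thesis using le unfolding t_def by blast
qed

end
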